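(* Let $(r_k)_{k\ge1}$ be a sequence of pairwise distinct positive real numbers and let $f\colon[0,\infty)\to\mathbb{R}$ be a real analytic function (analytic on $[0,\infty)$, including at $0$) such that the set $$U=\{u>0 : (f(r_ku))_{k\ge1}\in\mathcal{G}\}$$ is uncountable. Then $f$ is a polynomial.
   Context: A sequence of real numbers $(a_k)_{k\ge1}$ is called pointwise good (written $(a_k)\in\mathcal{G}$) if for every measure preserving flow $(U_t)_{t\in\mathbb{R}}$ on a probability space $(X,\mathcal{B},\mu)$ (a measurable action of $\mathbb{R}$ by measure preserving transformations) and every $F\in L^\infty(X,\mu)$, the averages $\frac1n\sum_{k=1}^n F(U_{a_k}x)$ converge for $\mu$-almost every $x$ as $n\to\infty$. *)

theory Defs
  imports "HOL-Probability.Probability" "HOL-Computational_Algebra.Polynomial"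
begin

definition mp_flow :: "'a measure \<Rightarrow> (real \<Rightarrow> 'a \<Rightarrow> 'a) \<Rightarrow> bool" where
  "mp_flow M U \<longleftrightarrow>
     prob_space M \<and>
     (\<lambda>(t, x). U t x) \<in> measurable (borel \<Otimes>\<^sub>M M) M \<and>
     (\<forall>t. U t \<in> measurable M M \<and>
          (\<forall>A \<in> sets M. emeasure M (U t -` A \<inter> space M) = emeasure M A)) \<and>
     (\<forall>x \<in> space M. U 0 x = x) \<and>
     (\<forall>s t. \<forall>x \<in> space M. U (s + t) x = U s (U t x))"

definition pointwise_good_on :: "'a itself \<Rightarrow> (nat \<Rightarrow> real) \<Rightarrow> bool" where
  "pointwise_good_on _ a \<longleftrightarrow>
     (\<forall>(M :: 'a measure) U F. mp_flow M U \<longrightarrow> F \<in> borel_measurable M \<longrightarrow>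
        (\<exists>C. \<forall>x \<in> space M. \<bar>F x\<bar> \<le> C) \<longrightarrow>
        (AE x in M. convergent (\<lambda>n. (\<Sum>k = 1..n. F (U (a k) x)) / real n)))"

text \<open>The class \<G>, with probability spaces carried by the reals (every standard
  probability space is isomorphic to one of these).\<close>
definition pointwise_good :: "(nat \<Rightarrow> real) \<Rightarrow> bool" where
  "pointwise_good a \<longleftrightarrow> pointwise_good_on TYPE(real) a"

definition real_analytic_on :: "(real \<Rightarrow> real) \<Rightarrow> real set \<Rightarrow> bool" where
  "real_analytic_on f S \<longleftrightarrow>
     (\<forall>x0 \<in> S. \<exists>c :: nat \<Rightarrow> real. \<exists>\<delta> > 0.
        \<forall>y \<in> S. \<bar>y - x0\<bar> < \<delta> \<longrightarrow> (\<lambda>n. c n * (y - x0) ^ n) sums f y)"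

end

theory Submission
  imports
    Defs
    "HOL-Analysis.Kronecker_Approximation_Theorem"
    "HOL-Complex_Analysis.Cauchy_Integral_Formula"
begin

text \<open>
  If \<open>f\<close> is not a polynomial, an integer relation between \<open>1\<close> and finitely many of the
  functions \<open>u \<mapsto> f (r k * u)\<close> holds for at most countably many \<open>u\<close>: otherwise it holds identically,
  and its Taylor coefficients at 0 force those of \<open>f\<close> to vanish from some index on. Hence for some
  \<open>u\<close> in the given uncountable set, \<open>1\<close> and the numbers \<open>a k = f (r k * u)\<close> are linearly
  independent over the integers. For such a sequence Kronecker's theorem provides integers \<open>m\<close> for
  which the \<open>m * a k\<close> modulo 1 approximate prescribed values on long successive blocks of \<open>k\<close>. With
  these one builds, for the unit speed rotation flow on the circle, a set of measure less than 1
  whose averages along \<open>a\<close> come arbitrarily close to 1 infinitely often at every point, so that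
  convergence almost everywhere would contradict the dominated convergence theorem.
\<close>

section \<open>Real analytic functions on the half-line\<close>

text \<open>Zeros are isolated: a nonzero coefficient would keep the sum away from 0 on a punctured
  neighbourhood of 0, by continuity if it is \<open>c 0\<close>, and by
  \<open>powser_0_nonzero\<close> once \<open>c 0 = 0\<close>.\<close>

lemma powser_coeff_eq_0_if_islimpt_zeros:
  fixes c :: "nat \<Rightarrow> real"
  assumes \<delta>: "\<delta> > 0"
    and summ: "\<And>z. \<bar>z\<bar> < \<delta> \<Longrightarrow> summable (\<lambda>n. c n * z ^ n)"
    and lim: "0 islimpt {z. (\<Sum>n. c n * z ^ n) = 0}"
  shows "c n = 0"
proof -
  define h where "h z = (\<Sum>n. c n * z ^ n)" for z
  have sm: "(\<lambda>n. c n * z ^ n) sums h z" if "\<bar>z\<bar> < \<delta>" for z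
    using summ[OF that] unfolding h_def by (rule summable_sums)
  have freq: "\<not> (\<forall>\<^sub>F z in at 0. h z \<noteq> 0)"
    using lim by (simp add: islimpt_iff_eventually h_def)
  have "(h \<longlongrightarrow> c 0) (at 0)"
    by (rule powser_limit_0[OF \<delta>]) (use sm in auto)
  then have c0: "c 0 = 0"
    using freq tendsto_imp_eventually_ne by blast
  show ?thesis
  proof (rule ccontr)
    assume cn: "c n \<noteq> 0"
    then have "n > 0" using c0 by (cases n) auto
    have h0: "h 0 = 0"
      using c0 by (simp add: h_def)
    obtain s where s: "0 < s" "\<And>z. z \<in> cball 0 s - {0} \<Longrightarrow> h z \<noteq> 0"
      by (rule powser_0_nonzero[where \<xi> = 0 and a = c and f = h, OF \<delta> _ h0 cn \<open>n > 0\<close>]) (use sm in auto)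
    have "\<forall>\<^sub>F z in at 0. h z \<noteq> 0"
      unfolding eventually_at using s by (intro exI[of _ s]) (auto simp: dist_commute)
    with freq show False by simp
  qed
qed

text \<open>At the endpoint \<open>x = 0\<close> the expansion is only given to the right.
  Convergence at a point of larger modulus on that side, here halfway between
  \<open>\<bar>z\<bar>\<close> and \<open>\<delta>\<close>, gives it on the left too.\<close>

lemma real_analytic_on_summable:
  assumes "x \<ge> 0" and \<delta>: "\<delta> > 0"
    and c: "\<And>y. y \<ge> 0 \<Longrightarrow> \<bar>y - x\<bar> < \<delta> \<Longrightarrow> (\<lambda>n. c n * (y - x) ^ n) sums g y"
    and z: "\<bar>z\<bar> < \<delta>"
  shows "summable (\<lambda>n. c n * z ^ n :: real)"
proof (rule powser_inside)
  show "summable (\<lambda>n. c n * ((\<bar>z\<bar> + \<delta>) / 2) ^ n)"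
    using c[of "x + (\<bar>z\<bar> + \<delta>) / 2"] assms(1) \<delta> z by (auto simp: sums_iff)
qed (use z in auto)

lemma real_analytic_on_zero_near_islimpt_zeros:
  assumes g: "real_analytic_on g {0..}" and x: "x \<ge> 0"
    and lim: "x islimpt {y. y \<ge> 0 \<and> g y = 0}"
  shows "\<exists>\<delta>>0. \<forall>y\<ge>0. \<bar>y - x\<bar> < \<delta> \<longrightarrow> g y = 0"
proof -
  obtain c \<delta> where \<delta>: "\<delta> > 0"
    and c: "\<And>y. y \<ge> 0 \<Longrightarrow> \<bar>y - x\<bar> < \<delta> \<Longrightarrow> (\<lambda>n. c n * (y - x) ^ n) sums g y"
    using g x unfolding real_analytic_on_def Ball_def atLeast_iff by meson
  have "0 islimpt {z. (\<Sum>n. c n * z ^ n) = 0}"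
    unfolding islimpt_approachable
  proof (intro allI impI)
    fix e :: real assume "e > 0"
    then obtain y where y: "y \<ge> 0" "g y = 0" "y \<noteq> x" "dist y x < min e \<delta>"
      using lim \<delta> unfolding islimpt_approachable by (metis (mono_tags, lifting) mem_Collect_eq min_less_iff_conj)
    have "(\<Sum>n. c n * (y - x) ^ n) = 0"
      using c[of y] y by (auto simp: dist_real_def sums_iff)
    with y show "\<exists>x'\<in>{z. (\<Sum>n. c n * z ^ n) = 0}. x' \<noteq> 0 \<and> dist x' 0 < e"
      by (intro bexI[of _ "y - x"]) (auto simp: dist_real_def)
  qed
  then have "c n = 0" for n
    using powser_coeff_eq_0_if_islimpt_zeros[OF \<delta> real_analytic_on_summable[OF x \<delta> c]] by blast
  then have "g y = 0" if "y \<ge> 0" "\<bar>y - x\<bar> < \<delta>" for y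
    using c[OF that] by (simp add: sums_iff)
  with \<delta> show ?thesis by blast
qed

text \<open>The accumulation points of the zero set form a closed subset of the half-line, which is
  also relatively open because \<open>g\<close> vanishes near each of them. Connectedness then
  leaves only the whole half-line.\<close>

lemma real_analytic_on_eq_0_if_islimpt_zeros:
  assumes g: "real_analytic_on g {0..}" and x: "x \<ge> 0"
    and lim: "x islimpt {y. y \<ge> 0 \<and> g y = 0}" and y: "y \<ge> 0"
  shows "g y = 0"
proof -
  define Z where "Z = {y. y \<ge> 0 \<and> g y = 0}"
  define T where "T = {0..} \<inter> {x. x islimpt Z}"
  have "closedin (top_of_set {0..}) T"
    unfolding T_def by (intro closedin_closed_Int closed_limpts)
  moreover have "openin (top_of_set {0..}) T"
    unfolding openin_euclidean_subtopology_iff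
  proof (intro conjI ballI)
    fix x assume "x \<in> T"
    then obtain \<delta> where \<delta>: "\<delta> > 0" "\<And>y. y \<ge> 0 \<Longrightarrow> \<bar>y - x\<bar> < \<delta> \<Longrightarrow> g y = 0"
      using real_analytic_on_zero_near_islimpt_zeros[OF g, of x] by (auto simp: T_def Z_def)
    have "x' islimpt Z" if x': "x' \<ge> 0" "\<bar>x' - x\<bar> < \<delta>" for x'
      unfolding islimpt_approachable
    proof (intro allI impI)
      fix e :: real assume e: "e > 0"
      \<comment> \<open>Moving to the right stays in the half-line even from
        \<open>x' = 0\<close>.\<close>
      obtain d where d: "d > 0" "d < e" "d < \<delta> - \<bar>x' - x\<bar>"
        using dense[of 0 "min e (\<delta> - \<bar>x' - x\<bar>)"] e x' by auto
      have "x' + d \<in> Z"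
        unfolding Z_def using \<delta>(2)[of "x' + d"] d x' by auto
      with d show "\<exists>z\<in>Z. z \<noteq> x' \<and> dist z x' < e"
        by (intro bexI[of _ "x' + d"]) (auto simp: dist_real_def)
    qed
    with \<delta>(1) show "\<exists>e>0. \<forall>x'\<in>{0..}. dist x' x < e \<longrightarrow> x' \<in> T"
      by (intro exI[of _ \<delta>]) (auto simp: T_def dist_real_def)
  qed (auto simp: T_def)
  ultimately have "T = {} \<or> T = {0..}"
    using connected_clopen[of "{0::real..}"] by auto
  moreover have "x \<in> T"
    using x lim by (auto simp: T_def Z_def)
  ultimately have "y islimpt Z"
    using y by (auto simp: T_def)
  then show ?thesis
    using real_analytic_on_zero_near_islimpt_zeros[OF g y] y by (auto simp: Z_def)
qed

text \<open>Some interval \<open>{0..real N}\<close> contains infinitely many of the zeros, and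
  compactness gives an accumulation point.\<close>

lemma real_analytic_on_eq_0_if_uncountable_zeros:
  assumes g: "real_analytic_on g {0..}"
    and unc: "uncountable {y. y \<ge> 0 \<and> g y = 0}" and y: "y \<ge> 0"
  shows "g y = 0"
proof -
  define Z where "Z = {y. y \<ge> 0 \<and> g y = 0}"
  have "Z = (\<Union>N. Z \<inter> {0..real N})"
    using real_arch_simple by (auto simp: Z_def)
  moreover have "countable (\<Union>N. Z \<inter> {0..real N})" if "\<And>N. countable (Z \<inter> {0..real N})"
    using that by (intro countable_UN) auto
  ultimately obtain N where "uncountable (Z \<inter> {0..real N})"
    using unc unfolding Z_def[symmetric] by force
  then have "infinite (Z \<inter> {0..real N})"
    using uncountable_infinite by blast
  then obtain x where "x \<in> {0..real N}" "x islimpt Z \<inter> {0..real N}"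
    using compact_Icc[of 0 "real N"] unfolding compact_eq_Bolzano_Weierstrass by blast
  then have "x \<ge> 0" "x islimpt Z"
    by (auto intro: islimpt_subset)
  then show ?thesis
    using real_analytic_on_eq_0_if_islimpt_zeros[OF g _ _ y] by (simp add: Z_def)
qed

section \<open>Closure properties of real analyticity\<close>

lemma real_analytic_on_add:
  assumes "real_analytic_on f S" "real_analytic_on g S"
  shows "real_analytic_on (\<lambda>x. f x + g x) S"
  unfolding real_analytic_on_def
proof
  fix x assume x: "x \<in> S"
  obtain c \<delta> where 1: "\<delta> > 0" "\<And>y. y \<in> S \<Longrightarrow> \<bar>y - x\<bar> < \<delta> \<Longrightarrow> (\<lambda>n. c n * (y - x) ^ n) sums f y"
    using assms(1) x unfolding real_analytic_on_def by meson
  obtain d \<epsilon> where 2: "\<epsilon> > 0" "\<And>y. y \<in> S \<Longrightarrow> \<bar>y - x\<bar> < \<epsilon> \<Longrightarrow> (\<lambda>n. d n * (y - x) ^ n) sums g y"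
    using assms(2) x unfolding real_analytic_on_def by meson
  have "(\<lambda>n. (c n + d n) * (y - x) ^ n) sums (f y + g y)" if "y \<in> S" "\<bar>y - x\<bar> < min \<delta> \<epsilon>" for y
    using sums_add[OF 1(2) 2(2), of y y] that by (simp add: distrib_right)
  then show "\<exists>c. \<exists>\<delta>>0. \<forall>y\<in>S. \<bar>y - x\<bar> < \<delta> \<longrightarrow> (\<lambda>n. c n * (y - x) ^ n) sums (f y + g y)"
    using 1(1) 2(1) by (intro exI[of _ "\<lambda>n. c n + d n"] exI[of _ "min \<delta> \<epsilon>"]) auto
qed

lemma real_analytic_on_cmult:
  assumes "real_analytic_on f S"
  shows "real_analytic_on (\<lambda>x. a * f x) S"
  unfolding real_analytic_on_def
proof
  fix x assume x: "x \<in> S"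
  obtain c \<delta> where 1: "\<delta> > 0" "\<And>y. y \<in> S \<Longrightarrow> \<bar>y - x\<bar> < \<delta> \<Longrightarrow> (\<lambda>n. c n * (y - x) ^ n) sums f y"
    using assms x unfolding real_analytic_on_def by meson
  have "(\<lambda>n. (a * c n) * (y - x) ^ n) sums (a * f y)" if "y \<in> S" "\<bar>y - x\<bar> < \<delta>" for y
    using sums_mult[OF 1(2)[OF that], of a] by (simp add: mult.assoc)
  then show "\<exists>c. \<exists>\<delta>>0. \<forall>y\<in>S. \<bar>y - x\<bar> < \<delta> \<longrightarrow> (\<lambda>n. c n * (y - x) ^ n) sums (a * f y)"
    using 1(1) by (intro exI[of _ "\<lambda>n. a * c n"] exI[of _ \<delta>]) auto
qed

lemma real_analytic_on_dilate:
  assumes "real_analytic_on f {0..}" and a: "a > 0"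
  shows "real_analytic_on (\<lambda>x. f (a * x)) {0..}"
  unfolding real_analytic_on_def
proof
  fix x :: real assume x: "x \<in> {0..}"
  obtain c \<delta> where 1: "\<delta> > 0" "\<And>y. y \<in> {0..} \<Longrightarrow> \<bar>y - a * x\<bar> < \<delta> \<Longrightarrow> (\<lambda>n. c n * (y - a * x) ^ n) sums f y"
    using assms(1) x a unfolding real_analytic_on_def by (metis atLeast_iff mult_nonneg_nonneg less_imp_le)
  have "(\<lambda>n. (c n * a ^ n) * (y - x) ^ n) sums (f (a * y))" if "y \<in> {0..}" "\<bar>y - x\<bar> < \<delta> / a" for y
  proof -
    have "\<bar>a * y - a * x\<bar> = a * \<bar>y - x\<bar>"
      using a by (simp add: abs_mult flip: right_diff_distrib)
    then have "\<bar>a * y - a * x\<bar> < \<delta>"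
      using that a by (simp add: field_simps)
    then show ?thesis
      using 1(2)[of "a * y"] that a by (simp add: mult.assoc power_mult_distrib flip: right_diff_distrib)
  qed
  then show "\<exists>c. \<exists>\<delta>>0. \<forall>y\<in>{0..}. \<bar>y - x\<bar> < \<delta> \<longrightarrow> (\<lambda>n. c n * (y - x) ^ n) sums f (a * y)"
    using 1(1) a by (intro exI[of _ "\<lambda>n. c n * a ^ n"] exI[of _ "\<delta> / a"]) auto
qed

lemma real_analytic_on_poly: "real_analytic_on (poly p) S"
  unfolding real_analytic_on_def
proof
  fix x :: real
  \<comment> \<open>The coefficients of \<open>p \<circ>\<^sub>p [:x, 1:]\<close> are the Taylor
    coefficients of \<open>p\<close> at \<open>x\<close>.\<close>
  have "(\<lambda>n. coeff (p \<circ>\<^sub>p [:x, 1:]) n * (y - x) ^ n) sums poly p y" for y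
  proof -
    have "(\<lambda>n. coeff (p \<circ>\<^sub>p [:x, 1:]) n * (y - x) ^ n) sums
        (\<Sum>n\<le>degree (p \<circ>\<^sub>p [:x, 1:]). coeff (p \<circ>\<^sub>p [:x, 1:]) n * (y - x) ^ n)"
      by (rule sums_finite) (auto simp: coeff_eq_0)
    then show ?thesis
      by (simp only: flip: poly_altdef) (simp add: poly_pcompose)
  qed
  then show "\<exists>c. \<exists>\<delta>>0. \<forall>y\<in>S. \<bar>y - x\<bar> < \<delta> \<longrightarrow> (\<lambda>n. c n * (y - x) ^ n) sums poly p y"
    by (intro exI[of _ "coeff (p \<circ>\<^sub>p [:x, 1:])"] exI[of _ 1]) auto
qed

lemma real_analytic_on_const: "real_analytic_on (\<lambda>x. a) S"
  using real_analytic_on_poly[of "[:a:]" S] by (simp add: real_analytic_on_def)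

lemma real_analytic_on_sum:
  assumes "\<And>k. k \<in> K \<Longrightarrow> real_analytic_on (f k) S"
  shows "real_analytic_on (\<lambda>x. \<Sum>k\<in>K. f k x) S"
  using assms
  by (induction K rule: infinite_finite_induct) (auto intro: real_analytic_on_add real_analytic_on_const)

section \<open>Linear relations between dilates of an analytic function\<close>

text \<open>Among the terms with nonzero coefficient the one with the largest base dominates: after
  division by its power every other term tends to 0, the bases being distinct and positive.\<close>

lemma eventually_exponential_sum_nonzero:
  fixes a r :: "'i \<Rightarrow> real"
  assumes fin: "finite K" and ex: "\<exists>k\<in>K. a k \<noteq> 0"
    and inj: "inj_on r K" and pos: "\<And>k. k \<in> K \<Longrightarrow> r k > 0"
  shows "\<forall>\<^sub>F m in sequentially. (\<Sum>k\<in>K. a k * r k ^ m) \<noteq> 0"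
proof -
  define L where "L = {k \<in> K. a k \<noteq> 0}"
  have L: "finite L" "L \<noteq> {}" using fin ex by (auto simp: L_def)
  have "Max (r ` L) \<in> r ` L" using L by (intro Max_in) auto
  then obtain k0 where k0: "k0 \<in> L" "r k0 = Max (r ` L)" by auto
  have max: "r k \<le> r k0" if "k \<in> L" for k
    unfolding k0(2) using L that by (intro Max_ge) auto
  have pos0: "r k0 > 0" using k0(1) pos by (auto simp: L_def)
  have "(\<lambda>m. \<Sum>k\<in>L. a k * (r k / r k0) ^ m) \<longlonglongrightarrow> (\<Sum>k\<in>L. if k = k0 then a k else 0)"
  proof (intro tendsto_sum)
    fix k assume k: "k \<in> L"
    show "(\<lambda>m. a k * (r k / r k0) ^ m) \<longlonglongrightarrow> (if k = k0 then a k else 0)"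
    proof (cases "k = k0")
      case False
      then have "r k \<noteq> r k0"
        using inj k k0(1) by (auto simp: L_def inj_on_def)
      then have "r k < r k0" "r k > 0"
        using max[OF k] pos k by (auto simp: L_def)
      then have "(\<lambda>m. (r k / r k0) ^ m) \<longlonglongrightarrow> 0"
        by (intro LIMSEQ_realpow_zero) auto
      then show ?thesis using False by (auto intro: tendsto_mult_right_zero)
    qed (use pos0 in auto)
  qed
  then have "(\<lambda>m. \<Sum>k\<in>L. a k * (r k / r k0) ^ m) \<longlonglongrightarrow> a k0"
    using L k0(1) by simp
  then have "\<forall>\<^sub>F m in sequentially. (\<Sum>k\<in>L. a k * (r k / r k0) ^ m) \<noteq> 0"
    by (rule tendsto_imp_eventually_ne) (use k0(1) in \<open>auto simp: L_def\<close>)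
  moreover have "(\<Sum>k\<in>K. a k * r k ^ m) = (\<Sum>k\<in>L. a k * (r k / r k0) ^ m) * r k0 ^ m" for m
  proof -
    have "(\<Sum>k\<in>K. a k * r k ^ m) = (\<Sum>k\<in>L. a k * r k ^ m)"
      by (rule sum.mono_neutral_right) (use fin in \<open>auto simp: L_def\<close>)
    then show ?thesis
      using pos0 by (simp add: sum_distrib_right power_divide)
  qed
  ultimately show ?thesis
    using pos0 by (auto elim: eventually_mono)
qed

text \<open>Comparing Taylor coefficients at 0: a relation that holds identically forces
  \<open>c m * (\<Sum>k. a k * r k ^ m) = 0\<close> for every \<open>m > 0\<close>, and the second factor is
  nonzero for large \<open>m\<close>.\<close>
lemma polynomial_if_uncountable_linear_relation:
  fixes r a :: "'i \<Rightarrow> real"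
  assumes f: "real_analytic_on f {0..}"
    and fin: "finite K" and ex: "\<exists>k\<in>K. a k \<noteq> 0"
    and inj: "inj_on r K" and pos: "\<And>k. k \<in> K \<Longrightarrow> r k > 0"
    and unc: "uncountable {u. u \<ge> 0 \<and> (\<Sum>k\<in>K. a k * f (r k * u)) = b}"
  shows "\<exists>p. \<forall>x\<ge>0. f x = poly p x"
proof -
  define g where "g u = (\<Sum>k\<in>K. a k * f (r k * u)) + - b" for u
  have g: "real_analytic_on g {0..}"
    unfolding g_def
    by (intro real_analytic_on_add real_analytic_on_const real_analytic_on_sum
        real_analytic_on_cmult real_analytic_on_dilate f pos)
  have g0: "g u = 0" if "u \<ge> 0" for u
    using real_analytic_on_eq_0_if_uncountable_zeros[OF g _ that] unc by (simp add: g_def)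
  obtain c \<delta> where \<delta>: "\<delta> > 0"
    and c: "\<And>y. y \<ge> 0 \<Longrightarrow> \<bar>y\<bar> < \<delta> \<Longrightarrow> (\<lambda>n. c n * y ^ n) sums f y"
    using f unfolding real_analytic_on_def by (metis atLeast_iff diff_zero order_refl)
  \<comment> \<open>For \<open>y < \<delta> / R\<close> every \<open>r k * y\<close> stays inside
    the interval where the expansion of \<open>f\<close> at 0 is valid.\<close>
  define R where "R = Max (insert 1 (r ` K))"
  have R: "R > 0" "\<And>k. k \<in> K \<Longrightarrow> r k \<le> R"
    using fin by (auto simp: R_def Max_gr_iff)
  \<comment> \<open>The Taylor coefficients of \<open>g\<close> at 0; the constant \<open>b\<close>
    enters only at index 0.\<close>
  define d where "d n = c n * (\<Sum>k\<in>K. a k * r k ^ n) - (if n = 0 then b else 0)" for n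
  have d: "(\<lambda>n. d n * y ^ n) sums 0" if y: "y \<ge> 0" "y < \<delta> / R" for y
  proof -
    have "(\<lambda>n. \<Sum>k\<in>K. a k * (c n * (r k * y) ^ n)) sums (\<Sum>k\<in>K. a k * f (r k * y))"
    proof (intro sums_sum sums_mult c)
      fix k assume k: "k \<in> K"
      show "r k * y \<ge> 0" using pos[OF k] y by simp
      have "r k * y \<le> R * y" using R(2)[OF k] y by (intro mult_right_mono) auto
      also have "\<dots> < \<delta>" using y R by (simp add: field_simps)
      finally show "\<bar>r k * y\<bar> < \<delta>" using \<open>r k * y \<ge> 0\<close> by simp
    qed
    moreover have "(\<lambda>n. if n = 0 then b else 0) sums b"
      using sums_single[of 0 "\<lambda>_. b"] by simp
    ultimately have "(\<lambda>n. (\<Sum>k\<in>K. a k * (c n * (r k * y) ^ n)) - (if n = 0 then b else 0))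
        sums ((\<Sum>k\<in>K. a k * f (r k * y)) - b)"
      by (rule sums_diff)
    moreover have "(\<Sum>k\<in>K. a k * f (r k * y)) - b = 0"
      using g0[OF y(1)] by (simp add: g_def)
    moreover have "(\<Sum>k\<in>K. a k * (c n * (r k * y) ^ n)) - (if n = 0 then b else 0) = d n * y ^ n" for n
      by (auto simp: d_def sum_distrib_left sum_distrib_right power_mult_distrib algebra_simps)
    ultimately show ?thesis by simp
  qed
  have \<delta>R: "\<delta> / R > 0" using \<delta> R by simp
  have d0: "d n = 0" for n
  proof (rule powser_coeff_eq_0_if_islimpt_zeros[OF \<delta>R])
    show "summable (\<lambda>n. d n * z ^ n)" if "\<bar>z\<bar> < \<delta> / R" for z
      by (rule real_analytic_on_summable[of 0 "\<delta> / R" d "\<lambda>_. 0"]) (use d \<delta>R that in auto)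
    show "0 islimpt {z. (\<Sum>n. d n * z ^ n) = 0}"
      unfolding islimpt_approachable
    proof (intro allI impI)
      fix e :: real assume e: "e > 0"
      obtain z where "z > 0" "z < e" "z < \<delta> / R"
        using dense[of 0 "min e (\<delta> / R)"] e \<delta>R by auto
      then show "\<exists>z\<in>{z. (\<Sum>n. d n * z ^ n) = 0}. z \<noteq> 0 \<and> dist z 0 < e"
        using d[of z] by (intro bexI[of _ z]) (auto simp: sums_iff)
    qed
  qed
  have prod0: "c n * (\<Sum>k\<in>K. a k * r k ^ n) = 0" if "n > 0" for n
    using d0[of n] that by (simp add: d_def)
  obtain M where M: "\<And>m. m \<ge> M \<Longrightarrow> (\<Sum>k\<in>K. a k * r k ^ m) \<noteq> 0"
    using eventually_exponential_sum_nonzero[OF fin ex inj pos] unfolding eventually_sequentially by blast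
  \<comment> \<open>\<open>Suc M\<close> instead of \<open>M\<close> excludes index 0, where
    \<open>b\<close> interferes.\<close>
  have c0: "c n = 0" if "n \<ge> Suc M" for n
    using prod0[of n] M[of n] that by simp
  define p where "p = (\<Sum>n\<le>M. monom (c n) n)"
  have near: "f y = poly p y" if "y \<ge> 0" "\<bar>y\<bar> < \<delta>" for y
  proof -
    have "(\<lambda>n. c n * y ^ n) sums (\<Sum>n\<le>M. c n * y ^ n)"
      by (rule sums_finite) (use c0 in auto)
    then show ?thesis
      using sums_unique2[OF c[OF that]] by (simp add: p_def poly_sum poly_monom)
  qed
  \<comment> \<open>Equality with \<open>p\<close> is known so far only near 0; the identity theorem
    applied to the difference extends it to the half-line.\<close>
  have "real_analytic_on (\<lambda>x. f x + (-1) * poly p x) {0..}"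
    by (intro real_analytic_on_add real_analytic_on_cmult real_analytic_on_poly f)
  moreover have "uncountable {y. y \<ge> 0 \<and> f y + (-1) * poly p y = 0}"
  proof
    assume "countable {y. y \<ge> 0 \<and> f y + (-1) * poly p y = 0}"
    then have "countable {0<..<\<delta>}"
      by (rule countable_subset[rotated]) (use near in auto)
    then show False using \<delta> uncountable_open_interval by blast
  qed
  ultimately have "f x + (-1) * poly p x = 0" if "x \<ge> 0" for x
    using real_analytic_on_eq_0_if_uncountable_zeros[OF _ _ that] by blast
  then show ?thesis by (intro exI[of _ p]) auto
qed

text \<open>There are only countably many integer relations, and each nontrivial one holds for
  countably many \<open>u\<close>, so together they cannot exhaust \<open>U\<close>.\<close>

lemma exists_independent_dilate:
  fixes r :: "nat \<Rightarrow> real"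
  assumes f: "real_analytic_on f {0..}" and np: "\<nexists>p. \<forall>x\<ge>0. f x = poly p x"
    and inj: "inj_on r {1..}" and pos: "\<And>k. k \<ge> 1 \<Longrightarrow> r k > 0"
    and unc: "uncountable U" and U: "U \<subseteq> {0..}"
  shows "\<exists>u\<in>U. \<forall>N n c. (\<exists>k\<in>{1..N}. n k \<noteq> 0) \<longrightarrow>
           (\<Sum>k=1..N. of_int (n k) * f (r k * u)) \<noteq> of_int c"
proof -
  \<comment> \<open>Finite lists make the set of relations countable. Lists start at 0, so a
    relation among the terms 1 to \<open>N\<close> becomes a list of length \<open>Suc N\<close>,
    read from entry 1 on.\<close>
  define B where "B = (\<lambda>(ns :: int list, c :: int).
    {u. u \<ge> 0 \<and> (\<Sum>k=1..<length ns. of_int (ns ! k) * f (r k * u)) = of_int c})"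
  define I where "I = {(ns :: int list, c :: int). \<exists>k\<in>{1..<length ns}. ns ! k \<noteq> 0}"
  have "countable (B i)" if "i \<in> I" for i
  proof -
    obtain ns c where i: "i = (ns, c)" by (cases i)
    show ?thesis
    proof (rule ccontr)
      assume "uncountable (B i)"
      then have "\<exists>p. \<forall>x\<ge>0. f x = poly p x"
        using that inj pos
        by (intro polynomial_if_uncountable_linear_relation[OF f, of "{1..<length ns}" "\<lambda>k. of_int (ns ! k)" r "of_int c"])
          (auto simp: i B_def I_def intro: inj_on_subset)
      with np show False by blast
    qed
  qed
  then have "countable (\<Union>i\<in>I. B i)"
    by (intro countable_UN) auto
  then obtain u where u: "u \<in> U" "u \<notin> (\<Union>i\<in>I. B i)"
    using unc by (meson countable_subset subsetI)
  show ?thesis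
  proof (intro bexI[OF _ u(1)] allI impI)
    fix N and n :: "nat \<Rightarrow> int" and c :: int
    assume n: "\<exists>k\<in>{1..N}. n k \<noteq> 0"
    define ns where "ns = map n [0..<Suc N]"
    have ns: "length ns = Suc N" "\<And>k. k \<le> N \<Longrightarrow> ns ! k = n k"
      by (auto simp: ns_def simp del: upt_Suc)
    have "(ns, c) \<in> I"
      using n ns by (auto simp: I_def)
    then have "u \<notin> B (ns, c)" using u(2) by blast
    moreover have "(\<Sum>k=1..<length ns. of_int (ns ! k) * f (r k * u)) = (\<Sum>k=1..N. of_int (n k) * f (r k * u))"
      by (rule sum.cong) (use ns in auto)
    ultimately show "(\<Sum>k=1..N. of_int (n k) * f (r k * u)) \<noteq> of_int c"
      using u(1) U by (auto simp: B_def)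
  qed
qed

section \<open>The rotation flow along an independent sequence\<close>

lemma Kronecker_approximation_int:
  fixes a \<alpha> :: "nat \<Rightarrow> real"
  assumes indep: "\<And>n c. \<exists>k\<in>{1..N}. n k \<noteq> 0 \<Longrightarrow> (\<Sum>k=1..N. of_int (n k) * a k) \<noteq> of_int c"
    and \<epsilon>: "\<epsilon> > 0"
  obtains m :: int and h :: "nat \<Rightarrow> int"
    where "\<And>k. k \<in> {1..N} \<Longrightarrow> \<bar>of_int m * a k - of_int (h k) - \<alpha> k\<bar> < \<epsilon>"
proof -
  interpret Modules.module "(\<lambda>r. (*) (real_of_int r))"
    by (simp add: Modules.module.intro distrib_left mult.commute)
  \<comment> \<open>\<open>Kronecker_thm_2\<close> yields an integer multiplier when the last number
    of the family is 1; the numbers \<open>a 1\<close>, ..., \<open>a N\<close> are shifted to start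
    at index 0.\<close>
  define \<theta> where "\<theta> i = (if i < N then a (Suc i) else 1)" for i
  \<comment> \<open>Coefficient vectors supported on one or two indices turn coincidences among the
    \<open>a i\<close> and 1 into integer relations, so independence also yields injectivity of
    \<open>\<theta>\<close>.\<close>
  have single: "(\<Sum>k=1..N. of_int (if k = i then 1 else 0) * a k) = a i" if "i \<in> {1..N}" for i
    using that by (simp add: if_distrib[of "\<lambda>x. real_of_int x * _"] if_distribR cong: if_cong)
  have a1: "a i \<noteq> 1" if "i \<in> {1..N}" for i
    using indep[of "\<lambda>k. if k = i then 1 else 0" 1] single[OF that] that by auto
  have aij: "a i \<noteq> a j" if "i \<in> {1..N}" "j \<in> {1..N}" "i \<noteq> j" for i j
  proof -
    have "(\<Sum>k=1..N. of_int ((if k = i then 1 else 0) - (if k = j then 1 else 0)) * a k) = a i - a j"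
      by (simp only: of_int_diff left_diff_distrib sum_subtractf single that)
    moreover have "\<exists>k\<in>{1..N}. (if k = i then 1 else 0) - (if k = j then 1 else 0) \<noteq> (0::int)"
      using that by (intro bexI[of _ i]) auto
    ultimately show ?thesis
      using indep[of "\<lambda>k. (if k = i then 1 else 0) - (if k = j then 1 else 0)" 0] by auto
  qed
  have inj: "inj_on \<theta> {..N}"
  proof (rule inj_onI)
    fix x y assume "x \<in> {..N}" "y \<in> {..N}" "\<theta> x = \<theta> y"
    then show "x = y"
      using a1[of "Suc x"] a1[of "Suc y"] aij[of "Suc x" "Suc y"] by (auto simp: \<theta>_def split: if_splits)
  qed
  have "independent (\<theta> ` {..N})"
  proof
    assume "dependent (\<theta> ` {..N})"
    then obtain u where u: "\<exists>v\<in>\<theta> ` {..N}. u v \<noteq> 0" "(\<Sum>v\<in>\<theta> ` {..N}. of_int (u v) * v) = 0"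
      by (subst (asm) dependent_finite) auto
    have "0 = (\<Sum>i\<le>N. of_int (u (\<theta> i)) * \<theta> i)"
      using u(2) by (simp add: sum.reindex[OF inj])
    also have "\<dots> = (\<Sum>i<N. of_int (u (a (Suc i))) * a (Suc i)) + of_int (u 1)"
      by (simp add: \<theta>_def flip: lessThan_Suc_atMost)
    also have "(\<Sum>i<N. of_int (u (a (Suc i))) * a (Suc i)) = (\<Sum>k=1..N. of_int (u (a k)) * a k)"
      by (rule sum.reindex_bij_witness[of _ "\<lambda>k. k - 1" Suc]) auto
    finally have rel: "(\<Sum>k=1..N. of_int (u (a k)) * a k) = of_int (- u 1)"
      by simp
    then have *: "\<forall>k\<in>{1..N}. u (a k) = 0"
      using indep[of "\<lambda>k. u (a k)" "- u 1"] by blast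
    with rel have "u 1 = 0" by simp
    with * u(1) show False by (auto simp: \<theta>_def)
  qed
  then obtain m h where mh: "\<And>i. i < N \<Longrightarrow> \<bar>of_int m * \<theta> i - of_int (h i) - \<alpha> (Suc i)\<bar> < \<epsilon>"
    using Kronecker_thm_2[of \<theta> N \<epsilon> "\<lambda>i. \<alpha> (Suc i)"] inj \<epsilon> by (auto simp: \<theta>_def)
  have "\<bar>of_int m * a k - of_int (h (k - 1)) - \<alpha> k\<bar> < \<epsilon>" if "k \<in> {1..N}" for k
    using mh[of "k - 1"] that by (auto simp: \<theta>_def)
  then show ?thesis
    by (rule that[of m "\<lambda>k. h (k - 1)"])
qed

section \<open>The circle and its rotation flow\<close>

text \<open>The circle R/Z, modelled on the reals because \<open>pointwise_good\<close> quantifies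
  over measures of that type.\<close>

definition circle :: "real measure" where
  "circle = restrict_space lborel {0..<1}"

definition rotation :: "real \<Rightarrow> real \<Rightarrow> real" where
  "rotation t x = frac (x + t)"

lemma space_circle [simp]: "space circle = {0..<1}"
  by (simp add: circle_def space_restrict_space)

lemma prob_space_circle: "prob_space circle"
  by (intro prob_spaceI) (simp add: circle_def emeasure_restrict_space space_restrict_space)

lemma borel_measurable_circle [measurable (raw)]:
  "f \<in> borel_measurable borel \<Longrightarrow> f \<in> borel_measurable circle"
  by (simp add: circle_def measurable_restrict_space1)

lemma borel_measurable_frac [measurable (raw)]:
  assumes [measurable]: "f \<in> borel_measurable M"
  shows "(\<lambda>x. frac (f x) :: real) \<in> borel_measurable M"
  unfolding frac_def by measurable

lemma measurable_circleI:
  assumes "f \<in> borel_measurable M" "\<And>x. x \<in> space M \<Longrightarrow> f x \<in> {0..<1}"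
  shows "f \<in> measurable M circle"
  unfolding circle_def by (rule measurable_restrict_space2) (use assms in auto)

lemma measurable_rotation [measurable]: "rotation t \<in> measurable circle circle"
  unfolding rotation_def
  by (rule measurable_circleI) (auto simp: frac_lt_1)

lemma emeasure_lborel_vimage_plus:
  fixes c :: "'a :: euclidean_space"
  assumes "B \<in> sets borel"
  shows "emeasure lborel ((+) c -` B) = emeasure lborel B"
proof -
  have "emeasure (distr lborel borel ((+) c)) B = emeasure lborel ((+) c -` B \<inter> space lborel)"
    by (rule emeasure_distr) (use assms in auto)
  then show ?thesis by (simp add: lborel_distr_plus)
qed

text \<open>Rotation is an exchange of two intervals: with \<open>s = frac t\<close>, it translates
  by \<open>s\<close> the points that land in \<open>{s..<1}\<close> and by \<open>s - 1\<close>
  those that land in \<open>{0..<s}\<close>. Lebesgue measure is translation invariant on each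
  piece.\<close>

lemma emeasure_rotation_vimage:
  assumes "A \<in> sets circle"
  shows "emeasure circle (rotation t -` A \<inter> space circle) = emeasure circle A"
proof -
  have A: "A \<subseteq> {0..<1}" and [measurable]: "A \<in> sets borel"
    using assms by (auto simp: circle_def sets_restrict_space_iff)
  define s where "s = frac t"
  have s: "0 \<le> s" "s < 1" by (auto simp: s_def frac_lt_1)
  have rot: "rotation t x = (if x + s < 1 then s + x else (s - 1) + x)" if "0 \<le> x" "x < 1" for x
  proof -
    have "frac x = x" using that by (simp add: frac_eq)
    then show ?thesis
      unfolding rotation_def s_def by (auto simp: frac_add)
  qed
  have split: "rotation t -` A \<inter> {0..<1} = ((+) s -` (A \<inter> {s..<1})) \<union> ((+) (s - 1) -` (A \<inter> {0..<s}))"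
    using s A by (auto simp: rot split: if_splits)
  have "emeasure circle (rotation t -` A \<inter> space circle) = emeasure lborel (rotation t -` A \<inter> {0..<1})"
    unfolding space_circle unfolding circle_def by (rule emeasure_restrict_space) auto
  also have "\<dots> = emeasure lborel ((+) s -` (A \<inter> {s..<1})) + emeasure lborel ((+) (s - 1) -` (A \<inter> {0..<s}))"
  proof -
    have "(+) c -` B \<in> sets lborel" if "B \<in> sets borel" for c :: real and B
      using measurable_sets[of "(+) c" borel borel B] that by simp
    then show ?thesis
      unfolding split by (intro plus_emeasure[symmetric]) auto
  qed
  also have "\<dots> = emeasure lborel (A \<inter> {s..<1}) + emeasure lborel (A \<inter> {0..<s})"
    by (simp add: emeasure_lborel_vimage_plus del: vimage_Int)
  also have "\<dots> = emeasure lborel ((A \<inter> {s..<1}) \<union> (A \<inter> {0..<s}))"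
    by (intro plus_emeasure) auto
  also have "(A \<inter> {s..<1}) \<union> (A \<inter> {0..<s}) = A"
    using A s by auto
  also have "emeasure lborel A = emeasure circle A"
    unfolding circle_def by (rule emeasure_restrict_space[symmetric]) (use A in auto)
  finally show ?thesis .
qed

lemma mp_flow_rotation: "mp_flow circle rotation"
  unfolding mp_flow_def
proof (intro conjI allI ballI prob_space_circle measurable_rotation emeasure_rotation_vimage)
  have [measurable]: "snd \<in> borel_measurable (borel \<Otimes>\<^sub>M circle)"
    by (rule measurable_compose[OF measurable_snd, of "\<lambda>x. x"]) auto
  show "(\<lambda>(t, x). rotation t x) \<in> borel \<Otimes>\<^sub>M circle \<rightarrow>\<^sub>M circle"
    unfolding rotation_def split_beta
    by (rule measurable_circleI) (auto simp: frac_lt_1)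
next
  fix x :: real assume "x \<in> space circle"
  then show "rotation 0 x = x" by (simp add: rotation_def frac_eq)
next
  fix s t x :: real
  show "rotation (s + t) x = rotation s (rotation t x)"
    by (simp add: rotation_def ac_simps)
qed

lemma integral_rotation:
  fixes F :: "real \<Rightarrow> real"
  assumes [measurable]: "F \<in> borel_measurable circle"
  shows "(\<integral>x. F (rotation t x) \<partial>circle) = (\<integral>x. F x \<partial>circle)"
proof -
  have "distr circle circle (rotation t) = circle"
    by (rule measure_eqI) (auto simp: emeasure_distr emeasure_rotation_vimage simp del: space_circle)
  then show ?thesis
    using integral_distr[OF measurable_rotation, of F t] by simp
qed

section \<open>Neighbourhoods of lattices and sweeping out\<close>

text \<open>For \<open>m \<noteq> 0\<close>, the neighbourhood of radius
  \<open>2 / (J * \<bar>m\<bar>)\<close> of the lattice (1/m)Z. The 2 leaves room for two errors of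
  size \<open>1 / J\<close>: Kronecker approximation and rounding to multiples of
  \<open>1 / J\<close>.\<close>

definition near_lattice :: "nat \<Rightarrow> int \<Rightarrow> real set" where
  "near_lattice J m = {x. \<exists>p::int. \<bar>of_int m * x - of_int p\<bar> < 2 / real J}"

lemma near_lattice_eq_UN:
  "near_lattice J m = (\<Union>p::int. {x. \<bar>of_int m * x - of_int p\<bar> < 2 / real J})"
  by (auto simp: near_lattice_def)

lemma borel_near_lattice [measurable]: "near_lattice J m \<in> sets borel"
  unfolding near_lattice_eq_UN by measurable

lemma near_lattice_frac: "frac x \<in> near_lattice J m \<longleftrightarrow> x \<in> near_lattice J m"
proof -
  have eq: "of_int m * frac x - of_int p = of_int m * x - of_int (p + m * \<lfloor>x\<rfloor>)" for p
    by (simp add: frac_def algebra_simps)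
  show ?thesis
    unfolding near_lattice_def mem_Collect_eq
  proof
    assume "\<exists>p. \<bar>real_of_int m * frac x - of_int p\<bar> < 2 / real J"
    then show "\<exists>p. \<bar>real_of_int m * x - of_int p\<bar> < 2 / real J"
      unfolding eq by blast
  next
    assume "\<exists>p. \<bar>real_of_int m * x - of_int p\<bar> < 2 / real J"
    then obtain p where "\<bar>real_of_int m * x - of_int p\<bar> < 2 / real J" by blast
    then show "\<exists>p. \<bar>real_of_int m * frac x - of_int p\<bar> < 2 / real J"
      unfolding eq by (intro exI[of _ "p - m * \<lfloor>x\<rfloor>"]) simp
  qed
qed

text \<open>At most \<open>2 * \<bar>m\<bar> + 1 \<le> 3 * \<bar>m\<bar>\<close> lattice points
  matter, each with an interval of length \<open>4 / (J * \<bar>m\<bar>)\<close>. The bound does not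
  depend on \<open>m\<close>, over which Kronecker's theorem gives no control.\<close>

lemma measure_near_lattice:
  assumes J: "J \<ge> 4" and m: "m \<noteq> 0"
  shows "measure circle (near_lattice J m \<inter> {0..<1}) \<le> 12 / real J"
proof -
  define \<rho> where "\<rho> = 2 / (real J * \<bar>of_int m\<bar>)"
  have \<rho>: "\<rho> > 0" using J m by (simp add: \<rho>_def)
  define P where "P = {-\<bar>m\<bar>..\<bar>m\<bar>}"
  have sub: "near_lattice J m \<inter> {0..<1} \<subseteq> (\<Union>p\<in>P. {of_int p / of_int m - \<rho> .. of_int p / of_int m + \<rho>})"
  proof
    fix x assume x: "x \<in> near_lattice J m \<inter> {0..<1}"
    then obtain p where p: "\<bar>of_int m * x - of_int p\<bar> < 2 / real J"
      by (auto simp: near_lattice_def)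
    have "2 / real J \<le> 1/2" using J by (simp add: field_simps)
    moreover have "\<bar>of_int m * x\<bar> \<le> \<bar>real_of_int m\<bar>"
      using x by (simp add: abs_mult mult_left_le)
    ultimately have "\<bar>real_of_int p\<bar> < \<bar>real_of_int m\<bar> + 1"
      using p by linarith
    then have "p \<in> P" unfolding P_def by simp linarith
    have "\<bar>x - of_int p / of_int m\<bar> = \<bar>of_int m * x - of_int p\<bar> / \<bar>of_int m\<bar>"
      using m by (simp add: diff_divide_distrib flip: abs_divide)
    also have "\<dots> \<le> \<rho>"
      using p m by (simp add: \<rho>_def field_simps)
    finally have "x \<in> {of_int p / of_int m - \<rho> .. of_int p / of_int m + \<rho>}" by (auto simp: abs_le_iff)
    with \<open>p \<in> P\<close> show "x \<in> (\<Union>p\<in>P. {of_int p / of_int m - \<rho> .. of_int p / of_int m + \<rho>})" by blast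
  qed
  have "measure circle (near_lattice J m \<inter> {0..<1}) = measure lborel (near_lattice J m \<inter> {0..<1})"
    unfolding circle_def by (rule measure_restrict_space) auto
  also have "\<dots> \<le> measure lborel (\<Union>p\<in>P. {of_int p / of_int m - \<rho> .. of_int p / of_int m + \<rho>})"
  proof (rule measure_mono_fmeasurable[OF sub])
    show "(\<Union>p\<in>P. {of_int p / of_int m - \<rho> .. of_int p / of_int m + \<rho>}) \<in> fmeasurable lborel"
      by (intro fmeasurable.finite_UN fmeasurableI) (auto simp: P_def emeasure_lborel_Icc_eq)
  qed auto
  also have "\<dots> \<le> (\<Sum>p\<in>P. measure lborel {of_int p / of_int m - \<rho> .. of_int p / of_int m + \<rho>})"
    by (rule measure_UNION_le) (auto simp: P_def)
  also have "\<dots> = real (card P) * (2 * \<rho>)"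
    using \<rho> by simp
  also have "\<dots> \<le> (3 * \<bar>of_int m\<bar>) * (2 * \<rho>)"
  proof (rule mult_right_mono)
    have "real (card P) = 2 * \<bar>of_int m\<bar> + 1" by (simp add: P_def)
    moreover have "\<bar>real_of_int m\<bar> \<ge> 1" using m by linarith
    ultimately show "real (card P) \<le> 3 * \<bar>of_int m\<bar>" by linarith
  qed (use \<rho> in auto)
  also have "\<dots> = 12 / real J"
    using m by (simp add: \<rho>_def)
  finally show ?thesis .
qed

text \<open>Kronecker's theorem lets \<open>m * a k\<close> be close to \<open>j / J\<close> modulo 1 for all \<open>k\<close> in the block
  \<open>J ^ (j - 1) < k \<le> J ^ j\<close>. Each block outweighs all the preceding ones, and some \<open>j\<close>
  moves \<open>m * x\<close> to within \<open>2 / J\<close> of an integer.\<close>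
lemma near_lattice_sweeps_out:
  fixes a :: "nat \<Rightarrow> real"
  assumes indep: "\<And>N n c. \<exists>k\<in>{1..N}. n k \<noteq> 0 \<Longrightarrow> (\<Sum>k=1..N. of_int (n k) * a k) \<noteq> of_int c"
    and J: "J \<ge> 4"
  shows "\<exists>m. m \<noteq> 0 \<and> (\<forall>x. \<exists>n\<ge>J. (\<Sum>k=1..n. indicator (near_lattice J m) (x + a k)) / real n \<ge> 1 - 1 / real J)"
proof -
  \<comment> \<open>The index of the block containing \<open>k\<close>.\<close>
  define lev where "lev k = (LEAST j. k \<le> J ^ j)" for k
  have lev: "lev k = j" if "J ^ (j - 1) < k" "k \<le> J ^ j" "j \<ge> 1" for j k
    unfolding lev_def
  proof (rule Least_equality)
    fix i assume i: "k \<le> J ^ i"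
    show "j \<le> i"
    proof (rule ccontr)
      assume "\<not> j \<le> i"
      then have "J ^ i \<le> J ^ (j - 1)" using J by (intro power_increasing) auto
      with i that(1) show False by simp
    qed
  qed (use that in auto)
  have \<epsilon>: "1 / real J > 0" using J by simp
  obtain m h where mh: "\<And>k. k \<in> {1..J ^ J} \<Longrightarrow>
      \<bar>of_int m * a k - of_int (h k) - real (lev k) / real J\<bar> < 1 / real J"
    using Kronecker_approximation_int[of "J ^ J" a "1 / real J" "\<lambda>k. real (lev k) / real J", OF indep \<epsilon>] by blast
  \<comment> \<open>The index \<open>J ^ 2\<close> lies in block 2, whose target
    \<open>2 / J\<close> is farther than \<open>1 / J\<close> from every integer since
    \<open>J \<ge> 4\<close>; the multiplier 0 cannot reach it.\<close>
  have "m \<noteq> 0"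
  proof
    assume "m = 0"
    have "J ^ 1 < J ^ 2" using J by (intro power_strict_increasing) auto
    then have "lev (J ^ 2) = 2" by (intro lev) auto
    moreover have "J ^ 2 \<in> {1..J ^ J}"
      using J by (auto intro: power_increasing)
    ultimately have "\<bar>real_of_int (h (J ^ 2)) + 2 / real J\<bar> < 1 / real J"
      using mh[of "J ^ 2"] \<open>m = 0\<close> by (simp add: abs_minus_commute)
    moreover have "1 / real J \<le> 1 / 4"
      using J by (simp add: field_simps)
    ultimately have "real_of_int (h (J ^ 2)) < 0" "real_of_int (h (J ^ 2)) > -1"
      by linarith+
    then have "h (J ^ 2) < 0" "-1 < h (J ^ 2)" by linarith+
    then show False by linarith
  qed
  moreover have "\<exists>n\<ge>J. (\<Sum>k=1..n. indicator (near_lattice J m) (x + a k)) / real n \<ge> 1 - 1 / real J" for x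
  proof -
    \<comment> \<open>\<open>y\<close> lies in the cell from \<open>q / J\<close> to
      \<open>(q + 1) / J\<close>; with \<open>j = J - q\<close>, adding \<open>j / J\<close> moves
      it to between 1 and \<open>1 + 1 / J\<close>, just above an integer.\<close>
    define y where "y = frac (of_int m * x)"
    define q where "q = \<lfloor>real J * y\<rfloor>"
    have y: "0 \<le> y" "y < 1" by (auto simp: y_def frac_lt_1)
    have q: "0 \<le> q" "q < int J"
      using y J by (auto simp: q_def floor_less_iff)
    define j where "j = nat (int J - q)"
    have j: "1 \<le> j" "j \<le> J" "real j = real J - of_int q"
      using q by (auto simp: j_def)
    have mem: "x + a k \<in> near_lattice J m" if k: "k \<in> {J ^ (j - 1)<..J ^ j}" for k
    proof -
      have "J ^ j \<le> J ^ J" using j J by (intro power_increasing) auto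
      then have "k \<in> {1..J ^ J}" using k by auto
      moreover have "lev k = j" using k j by (intro lev) auto
      ultimately have 1: "\<bar>of_int m * a k - of_int (h k) - real j / real J\<bar> < 1 / real J"
        using mh[of k] by simp
      have "of_int q \<le> real J * y" "real J * y < of_int q + 1"
        by (auto simp: q_def)
      then have "of_int q / real J \<le> y" "y < (of_int q + 1) / real J"
        using J by (auto simp: field_simps)
      moreover have "real j / real J = 1 - of_int q / real J"
        using J by (simp add: j(3) diff_divide_distrib)
      ultimately have 2: "0 \<le> y + real j / real J - 1" "y + real j / real J - 1 < 1 / real J"
        by (auto simp: add_divide_distrib)
      \<comment> \<open>The first bracket is the Kronecker error, the second the rounding
        error.\<close>
      have "of_int m * (x + a k) - of_int (\<lfloor>of_int m * x\<rfloor> + h k + 1)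
          = (of_int m * a k - of_int (h k) - real j / real J) + (y + real j / real J - 1)"
        by (simp add: y_def frac_def algebra_simps)
      also have "\<bar>\<dots>\<bar> < 2 / real J"
        using 1 2 by linarith
      finally show ?thesis unfolding near_lattice_def by blast
    qed
    have Jj: "J ^ j = J * J ^ (j - 1)"
      using j by (metis Suc_diff_1 One_nat_def Suc_le_eq power_Suc)
    have le: "J ^ (j - 1) \<le> J ^ j" unfolding Jj using J by simp
    \<comment> \<open>Block \<open>j\<close> alone fills all but the fraction \<open>1 / J\<close>
      of the indices up to \<open>J ^ j\<close>.\<close>
    have "real (J ^ j) - real (J ^ (j - 1)) = (\<Sum>k\<in>{J ^ (j - 1)<..J ^ j}. 1)"
      using le by (simp add: of_nat_diff)
    also have "\<dots> = (\<Sum>k\<in>{J ^ (j - 1)<..J ^ j}. indicator (near_lattice J m) (x + a k))"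
      by (rule sum.cong) (use mem in auto)
    also have "\<dots> \<le> (\<Sum>k=1..J ^ j. indicator (near_lattice J m) (x + a k))"
      by (rule sum_mono2) auto
    finally have "(real (J ^ j) - real (J ^ (j - 1))) / real (J ^ j)
        \<le> (\<Sum>k=1..J ^ j. indicator (near_lattice J m) (x + a k)) / real (J ^ j)"
      by (rule divide_right_mono) simp
    moreover have "(real (J ^ j) - real (J ^ (j - 1))) / real (J ^ j) = 1 - 1 / real J"
      unfolding Jj using J by (simp add: field_simps)
    moreover have "J ^ j \<ge> J"
      unfolding Jj using J by simp
    ultimately show ?thesis by (intro exI[of _ "J ^ j"]) auto
  qed
  ultimately show ?thesis by blast
qed

section \<open>Failure of almost everywhere convergence\<close>

text \<open>Wherever the averages converge, their limit must be 1, whereas invariance of the measure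
  fixes their integrals at the measure of \<open>E\<close>, at most 3/4.\<close>

lemma not_pointwise_good_if_independent:
  fixes a :: "nat \<Rightarrow> real"
  assumes indep: "\<And>N n c. \<exists>k\<in>{1..N}. n k \<noteq> 0 \<Longrightarrow> (\<Sum>k=1..N. of_int (n k) * a k) \<noteq> of_int c"
  shows "\<not> pointwise_good a"
proof
  assume good: "pointwise_good a"
  interpret prob_space circle by (rule prob_space_circle)
  \<comment> \<open>With this choice the bounds \<open>12 / J i\<close> form a geometric series of
    sum \<open>2 * 12 / 32 = 3 / 4 < 1\<close>.\<close>
  define J :: "nat \<Rightarrow> nat" where "J i = 2 ^ (i + 5)" for i
  have J4: "J i \<ge> 4" for i
    using power_increasing[of 2 "i + 5" "2::nat"] by (simp add: J_def)
  obtain m where m: "\<And>i. m i \<noteq> 0"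
    and sweep: "\<And>i x. \<exists>n\<ge>J i. (\<Sum>k=1..n. indicator (near_lattice (J i) (m i)) (x + a k)) / real n \<ge> 1 - 1 / real (J i)"
    using near_lattice_sweeps_out[OF indep J4] by metis
  define E where "E = (\<Union>i. near_lattice (J i) (m i))"
  have [measurable]: "E \<in> sets borel" unfolding E_def by measurable
  define F :: "real \<Rightarrow> real" where "F = indicator E"
  have F: "F \<in> borel_measurable circle" unfolding F_def by measurable
  have F01: "0 \<le> F x" "F x \<le> 1" for x by (auto simp: F_def indicator_def)
  have Frot: "F (rotation t x) = F (x + t)" for t x
    by (auto simp: F_def E_def rotation_def indicator_def near_lattice_frac)
  define avg where "avg n x = (\<Sum>k=1..n. F (rotation (a k) x)) / real n" for n x
  have avg_le: "avg n x \<le> 1" for n x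
    using sum_mono[of "{1..n}" "\<lambda>k. F (rotation (a k) x)" "\<lambda>_. 1"] F01
    by (cases "n = 0") (auto simp: avg_def field_simps)
  have avg_ge: "avg n x \<ge> 0" for n x
    unfolding avg_def by (intro divide_nonneg_nonneg sum_nonneg F01) auto
  have avg_meas [measurable]: "avg n \<in> borel_measurable circle" for n
    unfolding avg_def using measurable_compose[OF measurable_rotation F] by measurable
  have avg_large: "\<exists>n\<ge>J i. avg n x \<ge> 1 - 1 / real (J i)" for i x
  proof -
    obtain n where n: "n \<ge> J i"
      "(\<Sum>k=1..n. indicator (near_lattice (J i) (m i)) (x + a k)) / real n \<ge> 1 - 1 / real (J i)"
      using sweep by blast
    have "(\<Sum>k=1..n. indicator (near_lattice (J i) (m i)) (x + a k)) / real n \<le> avg n x"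
      unfolding avg_def Frot
      by (intro divide_right_mono sum_mono) (auto simp: F_def E_def indicator_def)
    with n show ?thesis by (intro exI[of _ n]) auto
  qed
  have lim1: "(\<lambda>n. avg n x) \<longlonglongrightarrow> 1" if conv: "convergent (\<lambda>n. avg n x)" for x
  proof -
    obtain L where L: "(\<lambda>n. avg n x) \<longlonglongrightarrow> L" using conv unfolding convergent_def by blast
    have "L \<le> 1"
      by (rule LIMSEQ_le_const2[OF L]) (use avg_le in auto)
    moreover have "\<not> L < 1"
    proof
      assume "L < 1"
      then have "\<forall>\<^sub>F n in sequentially. avg n x < (L + 1) / 2"
        by (intro order_tendstoD(2)[OF L]) auto
      then obtain n0 where n0: "\<And>n. n \<ge> n0 \<Longrightarrow> avg n x < (L + 1) / 2"
        by (auto simp: eventually_sequentially)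
      \<comment> \<open>Since \<open>J i \<ge> i\<close>, this puts the sweeping time beyond
        \<open>n0\<close> and makes \<open>1 / J i\<close> less than \<open>(1 - L) / 2\<close>, so
        an average there exceeds the midpoint \<open>(L + 1) / 2\<close>.\<close>
      obtain i where i: "real i > max (real n0) (2 / (1 - L))"
        using reals_Archimedean2 by blast
      have "i \<le> J i"
        unfolding J_def by (meson less_exp le_add1 less_imp_le order_trans power_increasing one_le_numeral)
      then have "1 / real (J i) \<le> 1 / real i"
        using i by (intro divide_left_mono) auto
      also have "1 / real i < (1 - L) / 2"
        using i \<open>L < 1\<close> by (auto simp: field_simps)
      finally have "1 - 1 / real (J i) > (L + 1) / 2" by (simp add: field_simps)
      moreover obtain n where "n \<ge> J i" "avg n x \<ge> 1 - 1 / real (J i)"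
        using avg_large by blast
      moreover have "n0 \<le> J i" using i \<open>i \<le> J i\<close> by auto
      ultimately show False using n0[of n] by linarith
    qed
    ultimately show ?thesis using L by simp
  qed
  have "AE x in circle. convergent (\<lambda>n. avg n x)"
  proof -
    have "\<exists>C. \<forall>x\<in>space circle. \<bar>F x\<bar> \<le> C"
      using F01 by (intro exI[of _ 1]) auto
    with good mp_flow_rotation F show ?thesis
      unfolding pointwise_good_def pointwise_good_on_def avg_def by blast
  qed
  then have "AE x in circle. (\<lambda>n. avg n x) \<longlonglongrightarrow> 1"
    by (rule AE_mp) (use lim1 in auto)
  then have "(\<lambda>n. \<integral>x. avg n x \<partial>circle) \<longlonglongrightarrow> (\<integral>x. 1 \<partial>circle)"
    by (intro integral_dominated_convergence[where w = "\<lambda>_. 1"])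
      (use avg_le avg_ge in auto)
  \<comment> \<open>At \<open>n = 0\<close> the average is 0 by the convention for division by zero,
    hence the restriction to \<open>n \<ge> 1\<close>.\<close>
  moreover have "(\<integral>x. avg n x \<partial>circle) = measure circle (E \<inter> {0..<1})" if "n \<ge> 1" for n
  proof -
    have int: "integrable circle (\<lambda>x. F (rotation t x))" for t
      by (rule integrable_const_bound[where B = 1])
        (use F01 measurable_compose[OF measurable_rotation F] in auto)
    have "(\<integral>x. avg n x \<partial>circle) = (\<Sum>k=1..n. \<integral>x. F (rotation (a k) x) \<partial>circle) / real n"
      unfolding avg_def using int by simp
    also have "\<dots> = (\<integral>x. F x \<partial>circle)"
      using that by (simp add: integral_rotation[OF F])
    finally show ?thesis by (simp add: F_def)
  qed
  then have "(\<lambda>n. \<integral>x. avg n x \<partial>circle) \<longlonglongrightarrow> measure circle (E \<inter> {0..<1})"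
    by (intro tendsto_eventually) (auto simp: eventually_sequentially)
  ultimately have "measure circle (E \<inter> {0..<1}) = 1"
    using LIMSEQ_unique prob_space by fastforce
  moreover have "measure circle (E \<inter> {0..<1}) \<le> 3 / 4"
  proof -
    have sets: "near_lattice (J i) (m i) \<inter> {0..<1} \<in> sets circle" for i
      by (auto simp: circle_def sets_restrict_space_iff)
    have sm: "(\<lambda>i. 12 / real (J i)) sums (3 / 4)"
      using sums_mult[OF geometric_sums[of "1/2 :: real"], of "12 / 32"]
      by (simp add: J_def power_add power_one_over divide_simps mult.commute)
    have sm': "summable (\<lambda>i. measure circle (near_lattice (J i) (m i) \<inter> {0..<1}))"
      by (rule summable_comparison_test'[OF sums_summable[OF sm], of 0])
        (use measure_near_lattice[OF J4 m] in auto)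
    have eq: "E \<inter> {0..<1} = (\<Union>i. near_lattice (J i) (m i) \<inter> {0..<1})"
      by (auto simp: E_def)
    have "measure circle (E \<inter> {0..<1}) \<le> (\<Sum>i. measure circle (near_lattice (J i) (m i) \<inter> {0..<1}))"
      unfolding eq by (rule finite_measure_subadditive_countably[OF _ sm']) (use sets in blast)
    also have "\<dots> \<le> (\<Sum>i. 12 / real (J i))"
      by (rule suminf_le[OF _ sm' sums_summable[OF sm]]) (rule measure_near_lattice[OF J4 m])
    also have "\<dots> = 3 / 4" using sm by (simp add: sums_iff)
    finally show ?thesis .
  qed
  ultimately show False by simp
qed

theorem theorem1:
  fixes r :: "nat \<Rightarrow> real" and f :: "real \<Rightarrow> real"
  assumes "inj_on r {1..}"
    and "\<And>k. k \<ge> 1 \<Longrightarrow> r k > 0"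
    and "real_analytic_on f {0..}"
    and "uncountable {u :: real. u > 0 \<and> pointwise_good (\<lambda>k. f (r k * u))}"
  shows "\<exists>p :: real poly. \<forall>x \<ge> 0. f x = poly p x"
proof (rule ccontr)
  assume np: "\<nexists>p :: real poly. \<forall>x \<ge> 0. f x = poly p x"
  define U where "U = {u :: real. u > 0 \<and> pointwise_good (\<lambda>k. f (r k * u))}"
  have U: "uncountable U" "U \<subseteq> {0..}"
    using assms(4) by (auto simp: U_def)
  obtain u where u: "u \<in> U"
    and indep: "\<forall>N n c. (\<exists>k\<in>{1..N}. n k \<noteq> 0) \<longrightarrow>
      (\<Sum>k=1..N. of_int (n k) * f (r k * u)) \<noteq> of_int c"
    using exists_independent_dilate[OF assms(3) np assms(1,2) U] by (rule bexE)
  show False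
    using not_pointwise_good_if_independent[OF indep[rule_format]] u by (simp add: U_def)
qed

end
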